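(* Let $T_k$ be a linear 4-tree with $k>1$ quadruples. Then $ex^{lin}_4(n,T_k)\le (3k-5)n$ for every positive integer $n$.
   Context: A quadruple system (4-uniform hypergraph) consists of a finite vertex set and a set of 4-element subsets of it, called edges or quadruples. It is linear if every pair of vertices is contained in at most one edge. It is $F$-free if it contains no subhypergraph isomorphic to $F$ (not necessarily induced). $ex^{lin}_4(n,F)$ is the maximum number of edges in an $F$-free linear quadruple system on $n$ vertices. A linear 4-tree is a 4-uniform hypergraph that can be constructed starting from a single quadruple and then, at each step, adding a new quadruple that intersects the union of the vertices of the previous quadruples in exactly one vertex. A linear 4-tree with $k$ quadruples has $3k+1$ vertices. *)

theory Defs
  imports Main
begin

type_synonym 'a hypergraph = "'a set \<times> 'a set set"

definition quadruple_system :: "'a hypergraph \<Rightarrow> bool" where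
  "quadruple_system H \<longleftrightarrow>
     (case H of (V, E) \<Rightarrow> finite V \<and> (\<forall>e\<in>E. e \<subseteq> V \<and> card e = 4))"

definition linear_system :: "'a hypergraph \<Rightarrow> bool" where
  "linear_system H \<longleftrightarrow>
     (case H of (V, E) \<Rightarrow>
        \<forall>x\<in>V. \<forall>y\<in>V. x \<noteq> y \<longrightarrow>
          (\<forall>e\<in>E. \<forall>f\<in>E. {x, y} \<subseteq> e \<longrightarrow> {x, y} \<subseteq> f \<longrightarrow> e = f))"

definition subhypergraph :: "'a hypergraph \<Rightarrow> 'a hypergraph \<Rightarrow> bool" where
  "subhypergraph H' H \<longleftrightarrow>
     fst H' \<subseteq> fst H \<and> snd H' \<subseteq> snd H \<and> (\<forall>e\<in>snd H'. e \<subseteq> fst H')"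

definition hypergraph_iso :: "'a hypergraph \<Rightarrow> 'b hypergraph \<Rightarrow> bool" where
  "hypergraph_iso F H \<longleftrightarrow>
     (\<exists>f. bij_betw f (fst F) (fst H) \<and> (\<lambda>e. f ` e) ` snd F = snd H)"

definition free_of :: "'a hypergraph \<Rightarrow> 'b hypergraph \<Rightarrow> bool" where
  "free_of F H \<longleftrightarrow> \<not> (\<exists>H'. subhypergraph H' H \<and> hypergraph_iso F H')"

text \<open>
  Every finite hypergraph is isomorphic to one whose vertices are natural numbers, so
  restricting the host systems to vertex type \<^typ>\<open>nat\<close> loses nothing.
\<close>

definition edge_counts :: "nat \<Rightarrow> 'a hypergraph \<Rightarrow> nat set" where
  "edge_counts n F =
     {card E | (V :: nat set) E. card V = n \<and> quadruple_system (V, E) \<and>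
        linear_system (V, E) \<and> free_of F (V, E)}"

definition ex_lin4 :: "nat \<Rightarrow> 'a hypergraph \<Rightarrow> nat" where
  "ex_lin4 n F = Max (edge_counts n F)"

inductive linear_4tree :: "'a hypergraph \<Rightarrow> bool" where
  single: "card e = 4 \<Longrightarrow> linear_4tree (e, {e})"
| extend: "linear_4tree (V, E) \<Longrightarrow> card e = 4 \<Longrightarrow> card (e \<inter> V) = 1
     \<Longrightarrow> linear_4tree (V \<union> e, insert e E)"

text \<open>The maximum in \<open>ex_lin4\<close> is over a finite set, which is nonempty if \<open>F\<close> has an edge.\<close>

lemma finite_edge_counts: "finite (edge_counts n F)"
proof (rule finite_subset)
  show "edge_counts n F \<subseteq> {..2 ^ n}"
  proof
    fix m assume "m \<in> edge_counts n F"
    then obtain V :: "nat set" and E where m: "m = card E" "card V = n"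
      and fin: "finite V" and sub: "E \<subseteq> Pow V"
      unfolding edge_counts_def quadruple_system_def by auto
    have "card E \<le> card (Pow V)" by (rule card_mono) (use fin sub in auto)
    then show "m \<in> {..2 ^ n}" using m fin by (simp add: card_Pow)
  qed
qed simp

lemma edge_counts_nonempty:
  assumes "snd F \<noteq> {}"
  shows "edge_counts n F \<noteq> {}"
proof -
  have "free_of F ({..<n}, {})"
    using assms unfolding free_of_def subhypergraph_def hypergraph_iso_def by auto
  then have "card ({} :: nat set set) \<in> edge_counts n F"
    unfolding edge_counts_def quadruple_system_def linear_system_def
    by (intro CollectI exI[of _ "{..<n}"] exI[of _ "{}"]) auto
  then show ?thesis by blast
qed

lemma linear_4tree_vertices_edges:
  "linear_4tree T \<Longrightarrow>
     quadruple_system T \<and> finite (snd T) \<and> snd T \<noteq> {} \<and> card (fst T) = 3 * card (snd T) + 1"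
proof (induction rule: linear_4tree.induct)
  case (single e)
  then have "finite e" by (metis card.infinite zero_neq_numeral)
  with single show ?case by (simp add: quadruple_system_def)
next
  case (extend V E e)
  then have fin: "finite V" "finite e" "finite E"
    by (auto simp: quadruple_system_def intro: card_ge_0_finite)
  have "e \<notin> E"
  proof
    assume "e \<in> E"
    then have "e \<inter> V = e" using extend by (auto simp: quadruple_system_def)
    then show False using extend by simp
  qed
  moreover have "card (V \<union> e) + 1 = card V + 4"
    using card_Un_Int[OF fin(1,2)] extend by (simp add: Int_commute)
  ultimately show ?case
    using extend fin by (auto simp: quadruple_system_def)
qed

end

theory Submission
  imports Defs
begin

text \<open>
  The theorem combines the usual passage to a subsystem of large minimum degree with a greedy
  embedding. If a system has more than \<open>c\<close> edges per vertex, deleting vertices of degree at most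
  \<open>c\<close> one by one destroys at most \<open>c\<close> edges each time, so the process ends with a nonempty
  subsystem in which all degrees exceed \<open>c\<close> (lemma \<open>exists_large_min_degree_subsystem\<close>).

  Take \<open>c = 3k - 5\<close> and embed the tree edge by edge. The next tree edge hangs at a vertex whose
  image \<open>v\<close> has to be in a host edge that avoids the rest of the partial image. By linearity every
  other vertex of the partial image spoils at most one of the edges at \<open>v\<close>. This alone would
  require degree \<open>3k - 2\<close>, as the image has up to \<open>3(k - 1) + 1\<close> vertices. The improvement
  comes from the fact that \<open>v\<close> already lies in an embedded edge, whose three other vertices together
  spoil only that single edge: at most \<open>1 + (3k - 6) = 3k - 5\<close> edges at \<open>v\<close> are spoiled, and one
  is left (lemmas \<open>exists_edge_avoiding\<close> and \<open>linear_4tree_embeds\<close>).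
\<close>

lemma linear_systemD:
  assumes "linear_system (V, E)" "quadruple_system (V, E)"
    and "x \<noteq> y" "e \<in> E" "g \<in> E" "x \<in> e" "y \<in> e" "x \<in> g" "y \<in> g"
  shows "e = g"
proof -
  have "x \<in> V" "y \<in> V" using assms by (auto simp: quadruple_system_def)
  then show ?thesis using assms unfolding linear_system_def by simp
qed

lemma finite_edges:
  assumes "quadruple_system (V, E)"
  shows "finite E"
  by (rule finite_subset[of _ "Pow V"]) (use assms in \<open>auto simp: quadruple_system_def\<close>)

lemma exists_large_min_degree_subsystem:
  assumes "quadruple_system (V, E)" "card E > c * card V"
  shows "\<exists>V' E'. V' \<subseteq> V \<and> E' \<subseteq> E \<and> E' \<noteq> {} \<and> quadruple_system (V', E') \<and>
           (\<forall>v\<in>V'. c < card {e \<in> E'. v \<in> e})"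
  using assms
proof (induction "card V" arbitrary: V E rule: less_induct)
  case less
  show ?case
  proof (cases "\<forall>v\<in>V. c < card {e \<in> E. v \<in> e}")
    case True
    have "E \<noteq> {}" using less.prems by auto
    with True less.prems show ?thesis by (intro exI[of _ V] exI[of _ E]) auto
  next
    case False
    then obtain v where v: "v \<in> V" "card {e \<in> E. v \<in> e} \<le> c" by auto
    let ?E = "{e \<in> E. v \<notin> e}"
    have finV: "finite V" using less.prems by (simp add: quadruple_system_def)
    have finE: "finite E" using less.prems finite_edges by blast
    have "card E = card ({e \<in> E. v \<in> e} \<union> ?E)" by (rule arg_cong[of _ _ card]) auto
    also have "\<dots> = card {e \<in> E. v \<in> e} + card ?E"
      using finE by (intro card_Un_disjoint) auto
    finally have split: "card E = card {e \<in> E. v \<in> e} + card ?E" .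
    have Suc: "card V = Suc (card (V - {v}))" using v finV by (metis card.remove)
    have "quadruple_system (V - {v}, ?E)"
      using less.prems by (auto simp: quadruple_system_def)
    moreover have "card ?E > c * card (V - {v})"
    proof -
      have "c * card V = c + c * card (V - {v})" unfolding Suc by simp
      then show ?thesis using split v less.prems by linarith
    qed
    ultimately obtain V' E' where "V' \<subseteq> V - {v}" "E' \<subseteq> ?E" "E' \<noteq> {}"
      "quadruple_system (V', E')" "\<forall>v\<in>V'. c < card {e \<in> E'. v \<in> e}"
      using less.hyps[of "V - {v}" ?E] Suc by auto
    then show ?thesis by (intro exI[of _ V'] exI[of _ E']) auto
  qed
qed

text \<open>
  Choosing one vertex of \<open>X\<close> on each of these edges is injective, since by linearity an edge is
  determined by \<open>v\<close> and a second vertex.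
\<close>

lemma card_edges_through_meeting_le:
  assumes lin: "linear_system (V, E)" "quadruple_system (V, E)"
    and X: "finite X" "v \<notin> X"
  shows "card {g \<in> E. v \<in> g \<and> g \<inter> X \<noteq> {}} \<le> card X"
proof -
  define u where "u g = (SOME y. y \<in> g \<inter> X)" for g
  have u: "u g \<in> g \<inter> X" if "g \<inter> X \<noteq> {}" for g
    unfolding u_def using that by (metis ex_in_conv someI_ex)
  have "inj_on u {g \<in> E. v \<in> g \<and> g \<inter> X \<noteq> {}}"
  proof (rule inj_onI)
    fix g h
    assume g: "g \<in> {g \<in> E. v \<in> g \<and> g \<inter> X \<noteq> {}}"
      and h: "h \<in> {g \<in> E. v \<in> g \<and> g \<inter> X \<noteq> {}}" and "u g = u h"
    then have "u g \<in> g" "u g \<in> h" "u g \<noteq> v" using u[of g] u[of h] X by auto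
    with g h show "g = h" using linear_systemD[OF lin, of v "u g" g h] by auto
  qed
  moreover have "u ` {g \<in> E. v \<in> g \<and> g \<inter> X \<noteq> {}} \<subseteq> X" using u by blast
  ultimately show ?thesis using X card_inj_on_le by blast
qed

text \<open>
  The degree bound beats the number of spoiled edges at \<open>v\<close>: the edge \<open>g\<^sub>0\<close> itself, and at most one
  edge for each of the \<open>card Y - 4\<close> vertices of \<open>Y\<close> outside \<open>g\<^sub>0\<close>.
\<close>

lemma exists_edge_avoiding:
  assumes lin: "linear_system (V, E)" "quadruple_system (V, E)"
    and g0: "g\<^sub>0 \<in> E" "v \<in> g\<^sub>0" "g\<^sub>0 \<subseteq> Y" and Y: "finite Y"
    and deg: "card Y < card {e \<in> E. v \<in> e} + 3"
  shows "\<exists>g\<in>E. g \<inter> Y = {v}"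
proof (rule ccontr)
  assume none: "\<not> ?thesis"
  have c4: "card g\<^sub>0 = 4" using g0 lin by (auto simp: quadruple_system_def)
  let ?S = "{g \<in> E. v \<in> g \<and> g \<inter> (Y - g\<^sub>0) \<noteq> {}}"
  have finE: "finite E" using finite_edges lin by blast
  have "{e \<in> E. v \<in> e} \<subseteq> insert g\<^sub>0 ?S"
  proof
    fix g assume g: "g \<in> {e \<in> E. v \<in> e}"
    then have "g \<inter> Y \<noteq> {v}" using none by auto
    then obtain y where y: "y \<in> g" "y \<in> Y" "y \<noteq> v" using g g0 by blast
    show "g \<in> insert g\<^sub>0 ?S"
    proof (cases "y \<in> g\<^sub>0")
      case True
      then have "g = g\<^sub>0" using linear_systemD[OF lin, of v y g g\<^sub>0] y g g0 by auto
      then show ?thesis by simp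
    next
      case False
      then show ?thesis using y g by auto
    qed
  qed
  then have "card {e \<in> E. v \<in> e} \<le> card (insert g\<^sub>0 ?S)"
    using finE by (intro card_mono) auto
  also have "\<dots> \<le> Suc (card ?S)" using finE by (simp add: card_insert_if)
  also have "card ?S \<le> card (Y - g\<^sub>0)"
    using card_edges_through_meeting_le[OF lin, of "Y - g\<^sub>0" v] Y g0 by auto
  also have "card (Y - g\<^sub>0) = card Y - 4"
    using c4 g0 Y by (metis card_Diff_subset finite_subset)
  finally have "card {e \<in> E. v \<in> e} \<le> Suc (card Y - 4)" by simp
  moreover have "4 \<le> card Y" using c4 g0 Y by (metis card_mono)
  ultimately show False using deg by simp
qed

lemma linear_4tree_vertex_in_edge:
  assumes "linear_4tree (W, F)" "x \<in> W"
  shows "\<exists>e\<in>F. x \<in> e"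
proof -
  have "linear_4tree T \<Longrightarrow> fst T \<subseteq> \<Union> (snd T)" for T :: "'a hypergraph"
    by (induction rule: linear_4tree.induct) auto
  from this[OF assms(1)] assms(2) show ?thesis by auto
qed

text \<open>
  The degree hypothesis refers to a fixed \<open>k\<close> rather than to \<open>card F\<close> so that it passes unchanged to
  the subtrees in the induction; \<open>3 * k \<le> deg + 4\<close> says \<open>deg > 3k - 5\<close> without truncated
  subtraction.
\<close>

lemma linear_4tree_embeds:
  assumes "linear_4tree (W, F)" "card F \<le> k"
    and lin: "linear_system (V, E)" "quadruple_system (V, E)" and "E \<noteq> {}"
    and deg: "\<And>v. v \<in> V \<Longrightarrow> 3 * k \<le> card {e \<in> E. v \<in> e} + 4"
  shows "\<exists>f. inj_on f W \<and> f ` W \<subseteq> V \<and> (\<forall>e\<in>F. f ` e \<in> E)"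
  using assms(1,2)
proof (induction W F rule: linear_4tree.induct[split_format(complete)])
  case (single e)
  obtain g where g: "g \<in> E" using \<open>E \<noteq> {}\<close> by auto
  then have "g \<subseteq> V" "card g = 4" using lin by (auto simp: quadruple_system_def)
  moreover have "finite e" "finite g" using single \<open>card g = 4\<close> by (auto intro: card_ge_0_finite)
  ultimately obtain f where "bij_betw f e g"
    using single finite_same_card_bij[of e g] by auto
  then show ?case using g \<open>g \<subseteq> V\<close> by (intro exI[of _ f]) (auto simp: bij_betw_def)
next
  case (extend W F e)
  have W: "finite W" "finite F" "card W = 3 * card F + 1" "\<And>d. d \<in> F \<Longrightarrow> d \<subseteq> W"
    using linear_4tree_vertices_edges[OF extend.hyps(1)] by (auto simp: quadruple_system_def)
  obtain x where x: "e \<inter> W = {x}" using extend.hyps by (auto simp: card_1_singleton_iff)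
  have "e \<notin> F" using W(4)[of e] extend.hyps by (auto simp: Int_absorb2)
  then have cF: "Suc (card F) \<le> k" using extend.prems W by simp
  then obtain f where f: "inj_on f W" "f ` W \<subseteq> V" "\<And>d. d \<in> F \<Longrightarrow> f ` d \<in> E"
    using extend.IH by auto
  obtain e0 where e0: "e0 \<in> F" "x \<in> e0"
    using linear_4tree_vertex_in_edge[OF extend.hyps(1)] x by blast
  (* The edge e0 already embedded at x is what exists_edge_avoiding takes as the edge at f x
     that lies inside the partial image. *)
  have "card (f ` W) = 3 * card F + 1" using f W by (simp add: card_image)
  moreover have "3 * k \<le> card {e \<in> E. f x \<in> e} + 4" using deg f x by blast
  ultimately have "card (f ` W) < card {e \<in> E. f x \<in> e} + 3" using cF by simp
  moreover have "f ` e0 \<subseteq> f ` W" using W(4)[OF e0(1)] by (rule image_mono)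
  ultimately obtain g where g: "g \<in> E" "g \<inter> f ` W = {f x}"
    using exists_edge_avoiding[OF lin, of "f ` e0" "f x" "f ` W"] e0 f(3) W(1) by auto
  have gV: "g \<subseteq> V" "card g = 4" using lin g by (auto simp: quadruple_system_def)
  have fin: "finite e" "finite g"
    using extend.hyps gV by (auto intro: card_ge_0_finite)
  have "x \<in> e" "f x \<in> g" using x g by auto
  then have "card (e - {x}) = card (g - {f x})" using extend.hyps gV by simp
  then obtain h where h: "bij_betw h (e - {x}) (g - {f x})"
    using finite_same_card_bij[of "e - {x}" "g - {f x}"] fin by auto
  define f' where "f' y = (if y \<in> W then f y else h y)" for y
  have f'W: "f' ` d = f ` d" if "d \<subseteq> W" for d using that by (force simp: f'_def)
  have ex: "e - W = e - {x}" using x by auto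
  have f'e: "f' ` (e - W) = g - {f x}"
    using h unfolding ex[symmetric] by (auto simp: bij_betw_def f'_def)
  have inj1: "inj_on f' W" using f(1) by (simp add: f'_def inj_on_def)
  have inj2: "inj_on f' (e - W)"
    using h unfolding ex[symmetric] by (auto simp: bij_betw_def f'_def inj_on_def)
  have "inj_on f' (W \<union> (e - W))"
    using inj1 inj2 f'W[of W] f'e g by (subst inj_on_Un) auto
  then have "inj_on f' (W \<union> e)" by simp
  moreover have "f' ` (W \<union> e) \<subseteq> V"
  proof -
    have "f' ` (W \<union> e) = f' ` W \<union> f' ` (e - W)" by auto
    then show ?thesis using f'W[of W] f'e f gV by auto
  qed
  moreover have "f' ` e = g"
  proof -
    have "e = insert x (e - W)" using x by auto
    then have "f' ` e = insert (f' x) (f' ` (e - W))" by (metis image_insert)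
    moreover have "f' x = f x" using x by (auto simp: f'_def)
    ultimately show ?thesis using f'e g by auto
  qed
  ultimately show ?case using f'W W f g by (intro exI[of _ f']) auto
qed

lemma not_free_of_if_embeds:
  assumes "quadruple_system (W, F)" "inj_on f W" "f ` W \<subseteq> V" "\<forall>e\<in>F. f ` e \<in> E"
  shows "\<not> free_of (W, F) (V, E)"
proof -
  let ?H = "(f ` W, (\<lambda>e. f ` e) ` F)"
  have "subhypergraph ?H (V, E)"
    using assms unfolding subhypergraph_def quadruple_system_def by fastforce
  moreover have "hypergraph_iso (W, F) ?H"
    using assms unfolding hypergraph_iso_def by (auto simp: bij_betw_def)
  ultimately show ?thesis unfolding free_of_def by blast
qed

lemma card_edges_le_if_tree_free:
  assumes T: "linear_4tree T" "card (snd T) = k" "k > 1"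
    and H: "quadruple_system (V, E)" "linear_system (V, E)" and free: "free_of T (V, E)"
  shows "card E \<le> (3 * k - 5) * card V"
proof (rule ccontr)
  assume "\<not> ?thesis"
  then obtain V' E' where sub: "V' \<subseteq> V" "E' \<subseteq> E" "E' \<noteq> {}" "quadruple_system (V', E')"
    and deg: "\<forall>v\<in>V'. 3 * k - 5 < card {e \<in> E'. v \<in> e}"
    using exists_large_min_degree_subsystem[OF H(1), of "3 * k - 5"] by auto
  have lin: "linear_system (V', E')"
    using H(2) sub unfolding linear_system_def by simp blast
  obtain W F where WF: "T = (W, F)" by fastforce
  have "3 * k \<le> card {e \<in> E'. v \<in> e} + 4" if "v \<in> V'" for v using deg T that by force
  then obtain f where "inj_on f W" "f ` W \<subseteq> V'" "\<forall>e\<in>F. f ` e \<in> E'"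
    using linear_4tree_embeds[of W F k V' E', OF _ _ lin sub(4,3)] T WF by fastforce
  moreover from this sub have "f ` W \<subseteq> V" "\<forall>e\<in>F. f ` e \<in> E" by blast+
  ultimately have "\<not> free_of T (V, E)"
    using not_free_of_if_embeds[of W F f V E] linear_4tree_vertices_edges[OF T(1)] WF by auto
  with free show False by simp
qed

theorem proposition1p1:
  fixes T :: "'a hypergraph" and k n :: nat
  assumes "linear_4tree T"
    and "card (snd T) = k"
    and "k > 1"
    and "n > 0"
  shows "int (ex_lin4 n T) \<le> (3 * int k - 5) * int n"
proof -
  have "snd T \<noteq> {}" using linear_4tree_vertices_edges assms by blast
  then have "ex_lin4 n T \<in> edge_counts n T"
    unfolding ex_lin4_def by (intro Max_in finite_edge_counts edge_counts_nonempty)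
  then have "ex_lin4 n T \<le> (3 * k - 5) * n"
    using card_edges_le_if_tree_free[OF assms(1-3)] unfolding edge_counts_def by auto
  then have "int (ex_lin4 n T) \<le> int ((3 * k - 5) * n)" by (simp only: of_nat_le_iff)
  also have "\<dots> = (3 * int k - 5) * int n" using assms(3) by (simp add: of_nat_diff)
  finally show ?thesis .
qed

end
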